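(* Let $\mathcal{H}$ be a finite-dimensional Hilbert space and let $A,B_1,\ldots,B_r$ be non-zero positive semidefinite operators on $\mathcal{H}$. Then $$P_e^*\Big(A,\sum_jB_j\Big)\le\sum_jF(A,B_j)\le\sum_j\sqrt{\operatorname{Tr}(A+B_j)}\sqrt{P_e^*(A,B_j)}.$$ If $A$ is of rank one then we also have both $$P_e^*\Big(A,\sum_jB_j\Big)\le\Big(\sum_j\operatorname{Tr}B_j\Big)\sum_jF\Big(\tfrac{A}{\operatorname{Tr}A},\tfrac{B_j}{\operatorname{Tr}B_j}\Big)^2\le\Big(\sum_j\operatorname{Tr}B_j\Big)\sum_j\frac{\operatorname{Tr}A+\operatorname{Tr}B_j}{(\operatorname{Tr}A)(\operatorname{Tr}B_j)}P_e^*(A,B_j)$$ and $$P_e^*\Big(A,\sum_jB_j\Big)\le\Big(\sum_j\sqrt{1+\tfrac{\operatorname{Tr}B_j}{\operatorname{Tr}A}}\sqrt{P_e^*(A,B_j)}\Big)^2\le\Big(\sum_j\Big(1+\tfrac{\operatorname{Tr}B_j}{\operatorname{Tr}A}\Big)\Big)\sum_jP_e^*(A,B_j).$$ All sums run over $j=1,\ldots,r$.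
   Context: For positive semidefinite operators $A,B$ on a finite-dimensional Hilbert space, $P_e^*(A,B):=\min\{\operatorname{Tr}A(I-E)+\operatorname{Tr}BE:\,0\le E\le I\}=\frac12\operatorname{Tr}(A+B)-\frac12\|A-B\|_1$, where $\|\cdot\|_1$ is the trace norm, and the fidelity is $F(A,B):=\|A^{1/2}B^{1/2}\|_1=\operatorname{Tr}(A^{1/2}BA^{1/2})^{1/2}$. *)

theory Defs
  imports "HOL-Analysis.Analysis"
begin

text \<open>A finite-dimensional complex Hilbert space is taken as \<open>complex ^ 'n\<close> with its standard
  inner product, and operators as matrices with respect to the standard orthonormal basis.\<close>

definition cinner :: "complex ^ 'n \<Rightarrow> complex ^ 'n \<Rightarrow> complex" where
  "cinner x y = (\<Sum>i\<in>UNIV. cnj (x $ i) * y $ i)"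

definition adj :: "complex ^ 'n ^ 'm \<Rightarrow> complex ^ 'm ^ 'n" where
  "adj A = map_matrix cnj (transpose A)"

definition psd :: "complex ^ 'n ^ 'n \<Rightarrow> bool" where
  "psd A \<longleftrightarrow> adj A = A \<and> (\<forall>x. 0 \<le> Re (cinner x (A *v x)))"

definition loewner_le :: "complex ^ 'n ^ 'n \<Rightarrow> complex ^ 'n ^ 'n \<Rightarrow> bool" where
  "loewner_le A B \<longleftrightarrow> psd (B - A)"

text \<open>Every trace that occurs below or in the theorem is that of a product of two positive
  semidefinite operators or of a single one, and is therefore real (and nonnegative).\<close>

abbreviation Tr :: "complex ^ 'n ^ 'n \<Rightarrow> real" where
  "Tr A \<equiv> Re (trace A)"

text \<open>The positive semidefinite square root, which exists and is unique when \<open>A\<close> is positive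
  semidefinite; it is not meant to be used for other arguments.\<close>

definition msqrt :: "complex ^ 'n ^ 'n \<Rightarrow> complex ^ 'n ^ 'n" where
  "msqrt A = (THE S. psd S \<and> S ** S = A)"

definition trace_norm :: "complex ^ 'n ^ 'n \<Rightarrow> real" where
  "trace_norm X = Tr (msqrt (adj X ** X))"

definition fidelity :: "complex ^ 'n ^ 'n \<Rightarrow> complex ^ 'n ^ 'n \<Rightarrow> real" where
  "fidelity A B = trace_norm (msqrt A ** msqrt B)"

text \<open>The infimum is a minimum: a continuous function is minimised over the nonempty compact set
  of all \<open>E\<close> with \<open>0 \<le> E \<le> I\<close>. The identity operator is \<open>mat 1\<close>.\<close>

definition opt_error :: "complex ^ 'n ^ 'n \<Rightarrow> complex ^ 'n ^ 'n \<Rightarrow> real" where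
  "opt_error A B =
    (INF E \<in> {E. loewner_le 0 E \<and> loewner_le E (mat 1)}. Tr (A ** (mat 1 - E)) + Tr (B ** E))"

end

theory Submission
  imports Defs
begin

text \<open>With \<open>S = msqrt A\<close> and \<open>T = msqrt (\<Sum>j. B j)\<close>, the projection onto the positive part of
  \<open>S - T\<close> has error at most \<open>Tr (S ** T)\<close>, as in the Powers-Stormer inequality. Writing
  \<open>T = (\<Sum>j. msqrt (B j) ** C j)\<close> with contractions \<open>C j\<close> and using that the trace norm dominates
  \<open>Tr (U ** X)\<close> for every contraction \<open>U\<close>, one bounds this by the sum of the fidelities. Conversely,
  the fidelity is \<open>Tr (U ** S ** T)\<close> for some contraction \<open>U\<close>; inserting \<open>E + (mat 1 - E)\<close> between
  \<open>S\<close> and \<open>T\<close> and applying Cauchy-Schwarz bounds its square by \<open>Tr (A + B)\<close> times the error of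
  the test \<open>E\<close>. If \<open>A\<close> has rank one then \<open>A ** X ** A = trace (A ** X) * A\<close>, so the squared fidelity
  is \<open>Tr (A ** B)\<close>, and the test \<open>A / Tr A\<close> has error \<open>Tr (A ** B) / Tr A\<close>.\<close>

section \<open>Adjoints and the inner product\<close>

lemma adj_nth: "adj A $ i $ j = cnj (A $ j $ i)"
  by (simp add: adj_def transpose_def)

lemma adj_adj [simp]: "adj (adj A) = A"
  by (simp add: vec_eq_iff adj_nth)

lemma adj_0 [simp]: "adj 0 = 0"
  by (simp add: vec_eq_iff adj_nth)

lemma adj_mat_1 [simp]: "adj (mat 1) = mat 1"
  by (simp add: vec_eq_iff adj_nth mat_def)

lemma adj_add: "adj (A + B) = adj A + adj B"
  by (simp add: vec_eq_iff adj_nth)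

lemma adj_diff: "adj (A - B) = adj A - adj B"
  by (simp add: vec_eq_iff adj_nth)

lemma adj_scaleR: "adj (c *\<^sub>R A) = c *\<^sub>R adj A"
  by (simp add: vec_eq_iff adj_nth)

lemma adj_sum: "adj (\<Sum>i\<in>I. A i) = (\<Sum>i\<in>I. adj (A i))"
  by (induction I rule: infinite_finite_induct) (simp_all add: adj_add)

lemma adj_mult: "adj (A ** B) = adj B ** adj A"
  by (simp add: vec_eq_iff adj_nth matrix_matrix_mult_def mult.commute)

lemma cinner_add_right: "cinner x (y + z) = cinner x y + cinner x z"
  by (simp add: cinner_def distrib_left sum.distrib)

lemma cinner_diff_right: "cinner x (y - z) = cinner x y - cinner x z"
  by (simp add: cinner_def right_diff_distrib sum_subtractf)

lemma cinner_0_right [simp]: "cinner x 0 = 0"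
  by (simp add: cinner_def)

lemma cinner_scale_right: "cinner x (c *s y) = c * cinner x y"
  by (simp add: cinner_def sum_distrib_left mult_ac)

lemma cinner_scaleR_right: "cinner x (c *\<^sub>R y) = of_real c * cinner x y"
  by (simp add: cinner_def sum_distrib_left scaleR_conv_of_real[where 'a = complex] mult_ac)

lemma cinner_scaleR_left: "cinner (c *\<^sub>R x) y = of_real c * cinner x y"
  by (simp add: cinner_def sum_distrib_left scaleR_conv_of_real[where 'a = complex] mult_ac)

lemma cinner_sum_right: "cinner x (\<Sum>i\<in>I. f i) = (\<Sum>i\<in>I. cinner x (f i))"
  by (induction I rule: infinite_finite_induct) (simp_all add: cinner_add_right)

lemma cnj_cinner: "cnj (cinner x y) = cinner y x"
  by (simp add: cinner_def mult.commute)

text \<open>Links the complex form to the real inner product of the underlying real space, whose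
  norm, orthogonality and Cauchy-Schwarz inequality are used from here on.\<close>

lemma Re_cinner_eq_inner: "Re (cinner x y) = inner x y"
  by (simp add: cinner_def inner_vec_def inner_complex_def)

lemma cinner_self: "cinner x x = of_real ((norm x)\<^sup>2)"
proof -
  have "cinner x x = of_real (Re (cinner x x))"
    by (simp add: complex_eq_iff cinner_def)
  then show ?thesis
    by (simp add: Re_cinner_eq_inner power2_norm_eq_inner)
qed

lemma cinner_adj_left: "cinner (adj A *v x) y = cinner x (A *v y)"
  unfolding cinner_def matrix_vector_mult_def adj_nth
  by (simp add: sum_distrib_left sum_distrib_right mult_ac) (rule sum.swap)

lemma cinner_hermitian: "adj A = A \<Longrightarrow> cinner (A *v x) y = cinner x (A *v y)"
  using cinner_adj_left[of A x y] by simp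

lemma matrix_vector_mult_scale: "(A :: complex ^ 'n ^ 'm) *v (c *s x) = c *s (A *v x)"
  by (simp add: vec_eq_iff matrix_vector_mult_def sum_distrib_left mult_ac)

lemma matrix_vector_scaleR: "(A :: complex ^ 'n ^ 'm) *v (c *\<^sub>R x) = c *\<^sub>R (A *v x)"
  by (simp add: vec_eq_iff matrix_vector_mult_def scaleR_sum_right)

lemma scaleR_matrix_vector: "(c *\<^sub>R A :: complex ^ 'n ^ 'm) *v x = c *\<^sub>R (A *v x)"
  by (simp add: vec_eq_iff matrix_vector_mult_def scaleR_sum_right)

lemma matrix_vector_mult_sum:
  "(A :: complex ^ 'n ^ 'm) *v (\<Sum>i\<in>I. f i) = (\<Sum>i\<in>I. A *v f i)"
  by (induction I rule: infinite_finite_induct) (simp_all add: matrix_vector_right_distrib)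

lemma sum_matrix_vector_mult:
  "(\<Sum>i\<in>I. f i :: complex ^ 'n ^ 'm) *v x = (\<Sum>i\<in>I. f i *v x)"
  by (induction I rule: infinite_finite_induct) (simp_all add: matrix_vector_mult_add_rdistrib)

lemma matrix_mult_sum_right:
  "(A :: complex ^ 'n ^ 'm) ** (\<Sum>i\<in>I. f i) = (\<Sum>i\<in>I. A ** f i)"
  by (induction I rule: infinite_finite_induct) (simp_all add: matrix_add_ldistrib)

lemma matrix_mult_scaleR:
  fixes A :: "complex ^ 'n ^ 'm"
  shows "(c *\<^sub>R A) ** B = c *\<^sub>R (A ** B)" "A ** (c *\<^sub>R B) = c *\<^sub>R (A ** B)"
  by (simp_all add: vec_eq_iff matrix_matrix_mult_def scaleR_sum_right)

lemma matrix_mult_diff: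
  fixes A :: "complex ^ 'n ^ 'm"
  shows "A ** (B - C) = A ** B - A ** C" "(A - D) ** B = A ** B - D ** B"
  by (simp_all add: vec_eq_iff matrix_matrix_mult_def right_diff_distrib left_diff_distrib
      sum_subtractf)

lemma trace_scaleR: "trace (c *\<^sub>R A :: complex ^ 'n ^ 'n) = c *\<^sub>R trace A"
  by (simp add: trace_def scaleR_sum_right)

lemma trace_zero [simp]: "trace 0 = 0"
  by (simp add: trace_def)

lemma trace_sum: "trace (\<Sum>i\<in>I. f i :: complex ^ 'n ^ 'n) = (\<Sum>i\<in>I. trace (f i))"
  by (induction I rule: infinite_finite_induct) (simp_all add: trace_add)

lemma trace_adj: "trace (adj A) = cnj (trace A)"
  by (simp add: trace_def adj_nth)

text \<open>The type-class inner product of matrices is the real part of the Hilbert-Schmidt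
  product, so \<open>norm\<close> of a matrix is its Hilbert-Schmidt norm and obeys
  Cauchy-Schwarz.\<close>

lemma Tr_adj_mult_eq_inner: "Tr (adj X ** Y) = inner X Y"
  unfolding trace_def matrix_matrix_mult_def adj_nth inner_vec_def
  by (simp add: inner_complex_def) (rule sum.swap)

lemma norm_adj: "norm (adj X) = norm X"
proof -
  have "inner (adj X) (adj X) = inner X X"
    using trace_mul_sym[of X "adj X"] by (simp flip: Tr_adj_mult_eq_inner)
  then show ?thesis
    by (simp add: norm_eq)
qed

section \<open>Orthonormal bases\<close>

text \<open>Completeness is stated as the expansion of every vector, the form in which it is used to
  compute traces and to compare operators.\<close>

definition onb :: "(complex ^ 'n) set \<Rightarrow> bool" where
  "onb S \<longleftrightarrow> finite S \<and> (\<forall>v\<in>S. \<forall>w\<in>S. cinner v w = (if v = w then 1 else 0)) \<and>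
    (\<forall>x. (\<Sum>v\<in>S. cinner v x *s v) = x)"

text \<open>The operator written \<open>|v><w|\<close> in Dirac notation, conjugate-linear in
  \<open>w\<close>.\<close>

definition outer :: "complex ^ 'n \<Rightarrow> complex ^ 'm \<Rightarrow> complex ^ 'm ^ 'n" where
  "outer v w = (\<chi> i j. v $ i * cnj (w $ j))"

lemma outer_mult_vector: "outer v w *v x = cinner w x *s v"
  by (simp add: vec_eq_iff outer_def matrix_vector_mult_def cinner_def sum_distrib_left mult_ac)

lemma adj_outer: "adj (outer v w) = outer w v"
  by (simp add: vec_eq_iff adj_nth outer_def)

lemma matrix_mult_outer: "A ** outer v w = outer (A *v v) w"
  by (simp add: vec_eq_iff outer_def matrix_matrix_mult_def matrix_vector_mult_def
      sum_distrib_left sum_distrib_right mult_ac)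

lemma trace_outer: "trace (outer v w) = cinner w v"
  by (simp add: trace_def outer_def cinner_def mult.commute)

lemma onb_finite: "onb S \<Longrightarrow> finite S"
  by (simp add: onb_def)

lemma onb_expand: "onb S \<Longrightarrow> (\<Sum>v\<in>S. cinner v x *s v) = x"
  by (simp add: onb_def)

lemma onb_cinner: "onb S \<Longrightarrow> v \<in> S \<Longrightarrow> w \<in> S \<Longrightarrow> cinner v w = (if v = w then 1 else 0)"
  by (simp add: onb_def)

lemma onb_norm: "onb S \<Longrightarrow> v \<in> S \<Longrightarrow> norm v = 1"
  using onb_cinner[of S v v] Re_cinner_eq_inner[of v v] by (simp add: norm_eq_1)

text \<open>Multiply by the resolution of the identity into the projections \<open>outer v v\<close>
  and use linearity of the trace.\<close>

lemma onb_trace: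
  assumes "onb S"
  shows "trace X = (\<Sum>v\<in>S. cinner v (X *v v))"
proof -
  have "mat 1 = (\<Sum>v\<in>S. outer v v)"
    using onb_expand[OF assms]
    by (simp add: matrix_eq sum_matrix_vector_mult outer_mult_vector)
  then have "trace X = trace (X ** (\<Sum>v\<in>S. outer v v))"
    by (metis matrix_mul_rid)
  then show ?thesis
    by (simp add: matrix_mult_sum_right matrix_mult_outer trace_sum trace_outer)
qed

lemma onb_eqI:
  assumes "onb S" "\<And>v. v \<in> S \<Longrightarrow> A *v v = B *v v"
  shows "A = B"
proof -
  have "A *v x = B *v x" for x
  proof -
    have "A *v (\<Sum>v\<in>S. cinner v x *s v) = B *v (\<Sum>v\<in>S. cinner v x *s v)"
      using assms(2) by (simp add: matrix_vector_mult_sum matrix_vector_mult_scale)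
    then show ?thesis
      by (simp add: onb_expand[OF assms(1)])
  qed
  then show ?thesis
    by (simp add: matrix_eq)
qed

section \<open>Eigenvectors by the Rayleigh quotient, and the spectral theorem\<close>

text \<open>A maximiser of the form \<open>inner x (A *v x)\<close> on the unit sphere of
  \<open>V\<close> is an eigenvector. Only a real subspace is involved, which is enough because the
  eigenvalue is real.\<close>

lemma exists_eigenvector:
  fixes A :: "complex ^ 'n ^ 'n" and V :: "(complex ^ 'n) set"
  assumes A: "adj A = A" and "subspace V" and inv: "\<And>x. x \<in> V \<Longrightarrow> A *v x \<in> V" and "V \<noteq> {0}"
  obtains u m where "u \<in> V" "norm u = 1" "A *v u = m *\<^sub>R u"
proof -
  let ?K = "V \<inter> sphere 0 1" and ?q = "\<lambda>x. inner x (A *v x)"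
  have K: "compact ?K"
    using closed_subspace[OF \<open>subspace V\<close>] by (simp add: closed_Int_compact)
  obtain y where "y \<in> V" "y \<noteq> 0"
    using \<open>V \<noteq> {0}\<close> subspace_0[OF \<open>subspace V\<close>] by blast
  then have "(1 / norm y) *\<^sub>R y \<in> ?K"
    using subspace_scale[OF \<open>subspace V\<close>] by simp
  then have "?K \<noteq> {}"
    by blast
  have "continuous_on ?K ?q"
    by (intro continuous_intros linear_continuous_on) simp
  from continuous_attains_sup[OF K \<open>?K \<noteq> {}\<close> this]
  obtain u where u: "u \<in> ?K" "\<And>y. y \<in> ?K \<Longrightarrow> ?q y \<le> ?q u"
    by blast
  \<comment> \<open>By scaling to the unit sphere, maximality of \<open>u\<close> makes the
    quadratic form of \<open>?q u *\<^sub>R x - A *v x\<close> nonnegative on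
    \<open>V\<close>.\<close>
  have nonneg: "0 \<le> inner x (?q u *\<^sub>R x - A *v x)" if "x \<in> V" for x
  proof (cases "x = 0")
    case False
    let ?y = "(1 / norm x) *\<^sub>R x"
    have "?y \<in> ?K"
      using that False subspace_scale[OF \<open>subspace V\<close>] by simp
    then have "?q ?y \<le> ?q u"
      by (rule u)
    moreover have "?q ?y = ?q x / (norm x)\<^sup>2"
      by (simp add: matrix_vector_scaleR power2_eq_square)
    ultimately have "?q x / (norm x)\<^sup>2 \<le> ?q u"
      by simp
    then have "?q x \<le> ?q u * (norm x)\<^sup>2"
      using False by (simp only: divide_le_eq) simp
    then show ?thesis
      by (simp add: inner_diff_right power2_norm_eq_inner)
  qed simp
  define w where "w = ?q u *\<^sub>R u - A *v u"
  have "w \<in> V"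
    using u(1) unfolding w_def
    by (intro subspace_diff[OF \<open>subspace V\<close>] subspace_scale[OF \<open>subspace V\<close>] inv) auto
  have "inner u w = 0"
    using u(1) by (simp add: w_def inner_diff_right flip: power2_norm_eq_inner)
  have sym: "inner x (A *v y) = inner y (A *v x)" for x y
    by (metis A Re_cinner_eq_inner cinner_hermitian inner_commute)
  let ?c = "inner w (?q u *\<^sub>R w - A *v w)"
  \<comment> \<open>The form vanishes at \<open>u\<close>. Moving from \<open>u\<close> along the
    residual \<open>w\<close> leaves the first-order term \<open>2 * t * (norm w)\<^sup>2\<close>,
    so a small negative \<open>t\<close> contradicts nonnegativity unless
    \<open>w = 0\<close>.\<close>
  have quad: "0 \<le> 2 * t * (norm w)\<^sup>2 + t\<^sup>2 * ?c" for t
  proof -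
    have "u + t *\<^sub>R w \<in> V"
      using u(1) \<open>w \<in> V\<close>
      by (intro subspace_add[OF \<open>subspace V\<close>] subspace_scale[OF \<open>subspace V\<close>]) auto
    then have "0 \<le> inner (u + t *\<^sub>R w) (?q u *\<^sub>R (u + t *\<^sub>R w) - A *v (u + t *\<^sub>R w))"
      by (rule nonneg)
    also have "?q u *\<^sub>R (u + t *\<^sub>R w) - A *v (u + t *\<^sub>R w) = w + t *\<^sub>R (?q u *\<^sub>R w - A *v w)"
      by (simp add: w_def matrix_vector_scaleR algebra_simps)
    also have "inner (u + t *\<^sub>R w) \<dots> =
        inner u w + t * (inner w w + inner u (?q u *\<^sub>R w - A *v w)) + t\<^sup>2 * ?c"
      by (simp add: inner_add_left inner_add_right power2_eq_square distrib_left)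
    also have "inner u (?q u *\<^sub>R w - A *v w) = inner w w"
    proof -
      have "inner u (?q u *\<^sub>R w - A *v w) = - inner w (A *v u)"
        using sym[of u w] \<open>inner u w = 0\<close> by (simp add: inner_diff_right)
      also have "\<dots> = inner w (?q u *\<^sub>R u - A *v u)"
        using \<open>inner u w = 0\<close> by (simp add: inner_diff_right inner_commute)
      finally show ?thesis
        by (simp add: w_def)
    qed
    finally show ?thesis
      using \<open>inner u w = 0\<close> by (simp add: power2_norm_eq_inner)
  qed
  have "w = 0"
  proof (rule ccontr)
    assume "w \<noteq> 0"
    define n where "n = (norm w)\<^sup>2"
    have "0 < n"
      using \<open>w \<noteq> 0\<close> by (simp add: n_def)
    have "0 \<le> ?c"
      by (rule nonneg[OF \<open>w \<in> V\<close>])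
    \<comment> \<open>This makes \<open>t * ?c\<close> exceed \<open>- n\<close>, so
      \<open>2 * n + t * ?c\<close> stays positive; the \<open>+ 1\<close> covers
      \<open>?c = 0\<close>.\<close>
    define t where "t = - n / (?c + 1)"
    have "0 \<le> t * (2 * n + t * ?c)"
      using quad[of t] by (simp add: n_def algebra_simps power2_eq_square)
    moreover have "t < 0"
      using \<open>0 < n\<close> \<open>0 \<le> ?c\<close> by (simp add: t_def divide_neg_pos)
    ultimately have "2 * n + t * ?c \<le> 0"
      by (simp add: zero_le_mult_iff)
    moreover have "t * ?c = - n * (?c / (?c + 1))"
      by (simp add: t_def)
    moreover have "n * (?c / (?c + 1)) \<le> n * 1"
      using \<open>0 < n\<close> \<open>0 \<le> ?c\<close> by (intro mult_left_mono) (simp_all add: divide_simps)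
    ultimately show False
      using \<open>0 < n\<close> by linarith
  qed
  then have "A *v u = ?q u *\<^sub>R u"
    by (simp add: w_def)
  then show ?thesis
    using that[of u "?q u"] u(1) by simp
qed

text \<open>A set of orthonormal eigenvectors of maximal cardinality is complete, because its orthogonal
  complement is invariant and would otherwise contain a further eigenvector.\<close>

theorem spectral_theorem:
  fixes A :: "complex ^ 'n ^ 'n"
  assumes A: "adj A = A"
  obtains S and l :: "complex ^ 'n \<Rightarrow> real"
  where "onb S" "\<And>v. v \<in> S \<Longrightarrow> A *v v = l v *\<^sub>R v"
proof -
  define P where "P = (\<lambda>S. finite S \<and>
    (\<forall>v\<in>S. \<forall>w\<in>S. cinner v w = (if v = w then 1 else 0)) \<and>
    (\<forall>v\<in>S. \<exists>l::real. A *v v = l *\<^sub>R v))"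
  \<comment> \<open>Members of \<open>S\<close> are orthogonal also for the real inner product,
    hence independent over the reals. The real dimension is twice the complex one, but any bound
    serves.\<close>
  have bound: "card S \<le> DIM(complex ^ 'n)" if "P S" for S
  proof -
    have "cinner v v = 1" if "v \<in> S" for v
      using \<open>P S\<close> that by (simp add: P_def)
    then have "0 \<notin> S"
      using cinner_0_right by (metis zero_neq_one)
    moreover have "pairwise orthogonal S"
      using \<open>P S\<close> by (auto simp: P_def pairwise_def orthogonal_def simp flip: Re_cinner_eq_inner)
    ultimately have "independent S"
      by (rule pairwise_orthogonal_independent[rotated])
    then show ?thesis
      by (rule independent_card_le)
  qed
  have "P {}"
    by (simp add: P_def)
  then obtain S where "P S" and max: "\<And>T. P T \<Longrightarrow> card T \<le> card S"
    using ex_has_greatest_nat[of P "{}" card "Suc DIM(complex ^ 'n)"] bound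
    unfolding less_Suc_eq_le by blast
  define V where "V = {x. \<forall>v\<in>S. cinner v x = 0}"
  have "subspace V"
    unfolding V_def by (auto simp: subspace_def cinner_add_right cinner_scaleR_right)
  moreover have "A *v x \<in> V" if "x \<in> V" for x
    unfolding V_def
  proof safe
    fix v assume "v \<in> S"
    then obtain l :: real where "A *v v = l *\<^sub>R v"
      using \<open>P S\<close> unfolding P_def by blast
    then show "cinner v (A *v x) = 0"
      using that \<open>v \<in> S\<close> cinner_hermitian[OF A, of v x] by (simp add: cinner_scaleR_left V_def)
  qed
  moreover have False if u: "u \<in> V" "norm u = 1" "A *v u = m *\<^sub>R u" for u m
  proof -
    have "u \<notin> S"
      using u cinner_self[of u] by (auto simp: V_def)
    moreover have "cinner v u = 0" "cinner u v = 0" if "v \<in> S" for v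
      using u(1) that cnj_cinner[of v u] by (simp_all add: V_def)
    moreover have "cinner u u = 1"
      using u by (simp add: cinner_self)
    ultimately have "P (insert u S)"
      using \<open>P S\<close> u(3) unfolding P_def by (metis finite_insert insert_iff)
    from max[OF this] show False
      using \<open>u \<notin> S\<close> \<open>P S\<close> by (simp add: P_def)
  qed
  ultimately have "V = {0}"
    using exists_eigenvector[OF A, of V] by blast
  have "(\<Sum>v\<in>S. cinner v x *s v) = x" for x
  proof -
    \<comment> \<open>The remainder of the expansion is orthogonal to \<open>S\<close>, so it lies
      in \<open>V\<close> and vanishes.\<close>
    have "cinner v (x - (\<Sum>w\<in>S. cinner w x *s w)) = 0" if "v \<in> S" for v
    proof -
      have "(\<Sum>w\<in>S. cinner w x * cinner v w) = (\<Sum>w\<in>S. if v = w then cinner v x else 0)"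
        using \<open>P S\<close> that by (intro sum.cong) (simp_all add: P_def)
      also have "\<dots> = cinner v x"
        using \<open>P S\<close> that by (simp add: P_def)
      finally show ?thesis
        by (simp add: cinner_diff_right cinner_sum_right cinner_scale_right)
    qed
    then have "x - (\<Sum>w\<in>S. cinner w x *s w) \<in> V"
      by (simp add: V_def)
    then show ?thesis
      by (simp add: \<open>V = {0}\<close>)
  qed
  then have "onb S"
    using \<open>P S\<close> by (simp add: onb_def P_def)
  moreover obtain l where "\<forall>v\<in>S. A *v v = l v *\<^sub>R v"
    using \<open>P S\<close> unfolding P_def by metis
  ultimately show ?thesis
    using that by blast
qed

section \<open>Positive semidefinite matrices\<close>

text \<open>Functional calculus in a fixed eigenbasis: square roots, pseudoinverses and spectral
  projections arise by changing the eigenvalue function \<open>f\<close>.\<close>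

definition onb_diag :: "(complex ^ 'n) set \<Rightarrow> (complex ^ 'n \<Rightarrow> real) \<Rightarrow> complex ^ 'n ^ 'n" where
  "onb_diag S f = (\<Sum>v\<in>S. f v *\<^sub>R outer v v)"

lemma adj_onb_diag [simp]: "adj (onb_diag S f) = onb_diag S f"
  by (simp add: onb_diag_def adj_sum adj_scaleR adj_outer)

lemma onb_diag_mult_vector: "onb_diag S f *v x = (\<Sum>v\<in>S. f v *\<^sub>R (cinner v x *s v))"
  by (simp add: onb_diag_def sum_matrix_vector_mult scaleR_matrix_vector outer_mult_vector)

lemma onb_diag_eigenvector:
  assumes "onb S" "w \<in> S"
  shows "onb_diag S f *v w = f w *\<^sub>R w"
proof -
  have "onb_diag S f *v w = (\<Sum>v\<in>S. if v = w then f w *\<^sub>R w else 0)"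
    unfolding onb_diag_mult_vector
    by (rule sum.cong) (simp_all add: onb_cinner[OF assms(1) _ assms(2)])
  then show ?thesis
    using assms onb_finite[OF assms(1)] by simp
qed

lemma onb_diag_eqI:
  assumes "onb S" "\<And>v. v \<in> S \<Longrightarrow> A *v v = f v *\<^sub>R v"
  shows "A = onb_diag S f"
  using assms by (intro onb_eqI[OF assms(1)]) (simp add: onb_diag_eigenvector)

lemma onb_diag_mult:
  assumes "onb S"
  shows "onb_diag S f ** onb_diag S g = onb_diag S (\<lambda>v. f v * g v)"
  using assms
  by (intro onb_diag_eqI)
    (simp_all add: onb_diag_eigenvector matrix_vector_scaleR mult.commute
      flip: matrix_vector_mul_assoc)

lemma onb_diag_cong: "(\<And>v. v \<in> S \<Longrightarrow> f v = g v) \<Longrightarrow> onb_diag S f = onb_diag S g"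
  by (simp add: onb_diag_def)

lemma inner_hermitian: "adj A = A \<Longrightarrow> inner (A *v x) y = inner x (A *v y)"
  by (simp add: cinner_hermitian flip: Re_cinner_eq_inner)

lemma inner_adj_left: "inner (adj A *v x) y = inner x (A *v y)"
  by (simp add: cinner_adj_left flip: Re_cinner_eq_inner)

lemma psd_iff_inner: "psd A \<longleftrightarrow> adj A = A \<and> (\<forall>x. 0 \<le> inner x (A *v x))"
  by (simp add: psd_def Re_cinner_eq_inner)

lemma psd_adj: "psd A \<Longrightarrow> adj A = A"
  by (simp add: psd_def)

lemma psd_inner_nonneg: "psd A \<Longrightarrow> 0 \<le> inner x (A *v x)"
  by (simp add: psd_iff_inner)

lemma psd_0: "psd 0"
  by (simp add: psd_def)

lemma psd_add: "psd A \<Longrightarrow> psd B \<Longrightarrow> psd (A + B)"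
  by (simp add: psd_iff_inner adj_add matrix_vector_mult_add_rdistrib inner_add_right)

lemma psd_sum: "(\<And>i. i \<in> I \<Longrightarrow> psd (f i)) \<Longrightarrow> psd (\<Sum>i\<in>I. f i)"
  by (induction I rule: infinite_finite_induct) (simp_all add: psd_0 psd_add)

lemma psd_scaleR: "psd A \<Longrightarrow> 0 \<le> c \<Longrightarrow> psd (c *\<^sub>R A)"
  by (simp add: psd_iff_inner adj_scaleR scaleR_matrix_vector)

lemma inner_adj_mult_self: "inner x ((adj X ** X) *v x) = (norm (X *v x))\<^sup>2"
  using inner_adj_left[of "adj X" x "X *v x"]
  by (simp add: power2_norm_eq_inner flip: matrix_vector_mul_assoc)

lemma psd_adj_mult_self: "psd (adj X ** X)"
  by (simp add: psd_iff_inner inner_adj_mult_self adj_mult)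

text \<open>Taking roots of the eigenvalues exhibits the operator as
  \<open>adj R ** R\<close>.\<close>

lemma psd_onb_diag:
  assumes "onb S" "\<And>v. v \<in> S \<Longrightarrow> 0 \<le> f v"
  shows "psd (onb_diag S f)"
proof -
  let ?R = "onb_diag S (\<lambda>v. sqrt (f v))"
  have "onb_diag S f = adj ?R ** ?R"
    using assms by (simp add: onb_diag_mult cong: onb_diag_cong)
  then show ?thesis
    by (simp only: psd_adj_mult_self)
qed

lemma onb_Tr: "onb S \<Longrightarrow> Tr X = (\<Sum>v\<in>S. inner v (X *v v))"
  by (simp add: onb_trace[of S] Re_cinner_eq_inner)

lemma psd_eigenvalue_nonneg:
  assumes "psd A" "A *v v = l *\<^sub>R v" "norm v = 1"
  shows "0 \<le> l"
  using psd_inner_nonneg[OF assms(1), of v] assms(2,3) by (simp add: norm_eq_1)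

lemma psd_spectral:
  assumes "psd A"
  obtains S l where "onb S" "A = onb_diag S l" "\<And>v. v \<in> S \<Longrightarrow> 0 \<le> l v"
proof -
  obtain S l where S: "onb S" and l: "\<And>v. v \<in> S \<Longrightarrow> A *v v = l v *\<^sub>R v"
    using spectral_theorem[OF psd_adj[OF assms]] by blast
  show ?thesis
  proof (rule that)
    show "onb S" by fact
    show "A = onb_diag S l"
      using S l by (rule onb_diag_eqI)
    show "0 \<le> l v" if "v \<in> S" for v
      using assms l[OF that] onb_norm[OF S that] by (rule psd_eigenvalue_nonneg)
  qed
qed

text \<open>The product itself may fail to be Hermitian, but in an eigenbasis of \<open>B\<close>
  its trace is a sum of terms \<open>l v * inner v (A *v v)\<close>.\<close>

lemma Tr_mult_psd_nonneg:
  assumes "psd A" "psd B"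
  shows "0 \<le> Tr (A ** B)"
proof -
  obtain S l where S: "onb S" "B = onb_diag S l" "\<And>v. v \<in> S \<Longrightarrow> 0 \<le> l v"
    using psd_spectral[OF assms(2)] by blast
  have "Tr (A ** B) = (\<Sum>v\<in>S. l v * inner v (A *v v))"
    using S(1,2) by (simp add: onb_Tr onb_diag_eigenvector matrix_vector_scaleR
        flip: matrix_vector_mul_assoc)
  then show ?thesis
    using S(3) psd_inner_nonneg[OF assms(1)] by (simp add: sum_nonneg)
qed

lemma psd_Tr_nonneg:
  assumes "psd A"
  shows "0 \<le> Tr A"
proof -
  have "psd (mat 1 :: complex ^ 'n ^ 'n)"
    using psd_adj_mult_self[of "mat 1"] by simp
  from Tr_mult_psd_nonneg[OF assms this] show ?thesis
    by simp
qed

text \<open>The trace is the sum of the nonnegative eigenvalues.\<close>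

lemma psd_Tr_eq_0_iff:
  assumes "psd A"
  shows "Tr A = 0 \<longleftrightarrow> A = 0"
proof
  obtain S l where S: "onb S" "A = onb_diag S l" "\<And>v. v \<in> S \<Longrightarrow> 0 \<le> l v"
    using psd_spectral[OF assms] by blast
  assume "Tr A = 0"
  moreover have "Tr A = (\<Sum>v\<in>S. l v)"
    using S(1,2) by (simp add: onb_Tr onb_diag_eigenvector onb_norm flip: power2_norm_eq_inner)
  ultimately have "\<forall>v\<in>S. l v = 0"
    using S(3) onb_finite[OF S(1)] by (simp add: sum_nonneg_eq_0_iff)
  then show "A = 0"
    by (simp add: S(2) onb_diag_def)
qed simp

section \<open>Square roots\<close>

text \<open>A difference of squares without commutativity: symmetry of the real inner product
  cancels the cross terms. It serves both uniqueness of square roots and the Powers-Stormer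
  estimate.\<close>

lemma inner_square_diff:
  assumes "adj S = S" "adj T = T" "(S - T) *v v = d *\<^sub>R v"
  shows "inner v ((S ** S - T ** T) *v v) = d * inner v ((S + T) *v v)"
proof -
  have "inner v ((S ** S - T ** T) *v v) = inner (S *v v) (S *v v) - inner (T *v v) (T *v v)"
    by (simp add: inner_hermitian assms matrix_vector_mult_diff_rdistrib inner_diff_right
        flip: matrix_vector_mul_assoc)
  also have "\<dots> = inner ((S - T) *v v) ((S + T) *v v)"
    by (simp add: matrix_vector_mult_diff_rdistrib matrix_vector_mult_add_rdistrib
        inner_diff_left inner_add_right inner_commute[of "T *v v" "S *v v"])
  finally show ?thesis
    by (simp add: assms(3))
qed

text \<open>At an eigenvector \<open>v\<close> of \<open>S - T\<close> with eigenvalue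
  \<open>d v\<close> nonzero, equality of the squares forces both \<open>S\<close> and
  \<open>T\<close> to have zero quadratic form at \<open>v\<close>, whence \<open>d v = 0\<close>
  after all.\<close>

lemma psd_sqrt_unique:
  assumes "psd S" "psd T" "S ** S = T ** T"
  shows "S = T"
proof -
  have "adj (S - T) = S - T"
    using assms by (simp add: adj_diff psd_adj)
  then obtain V d where V: "onb V" and d: "\<And>v. v \<in> V \<Longrightarrow> (S - T) *v v = d v *\<^sub>R v"
    using spectral_theorem by blast
  have "d v = 0" if "v \<in> V" for v
  proof (rule ccontr)
    assume "d v \<noteq> 0"
    have "d v * inner v ((S + T) *v v) = 0"
      using inner_square_diff[OF psd_adj psd_adj d[OF that], OF assms(1,2)] assms(3) by simp
    then have "inner v (S *v v) + inner v (T *v v) = 0"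
      using \<open>d v \<noteq> 0\<close> by (simp add: matrix_vector_mult_add_rdistrib inner_add_right)
    then have "inner v ((S - T) *v v) = 0"
      using psd_inner_nonneg[OF assms(1), of v] psd_inner_nonneg[OF assms(2), of v]
      by (simp add: matrix_vector_mult_diff_rdistrib inner_diff_right)
    then show False
      using \<open>d v \<noteq> 0\<close> onb_norm[OF V that] by (simp add: d[OF that] flip: power2_norm_eq_inner)
  qed
  then have "S - T = 0"
    using d by (intro onb_eqI[OF V]) simp
  then show ?thesis
    by simp
qed

lemma psd_sqrt_exists:
  assumes "psd A"
  shows "\<exists>S. psd S \<and> S ** S = A"
proof -
  obtain V l where V: "onb V" "A = onb_diag V l" "\<And>v. v \<in> V \<Longrightarrow> 0 \<le> l v"
    using psd_spectral[OF assms] by blast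
  then have "onb_diag V (\<lambda>v. sqrt (l v)) ** onb_diag V (\<lambda>v. sqrt (l v)) = A"
    by (simp add: onb_diag_mult cong: onb_diag_cong)
  moreover have "psd (onb_diag V (\<lambda>v. sqrt (l v)))"
    using V by (simp add: psd_onb_diag)
  ultimately show ?thesis
    by blast
qed

lemma msqrt_eqI: "psd S \<Longrightarrow> S ** S = A \<Longrightarrow> msqrt A = S"
  unfolding msqrt_def by (rule the_equality) (auto intro: psd_sqrt_unique)

lemma psd_msqrt: "psd A \<Longrightarrow> psd (msqrt A)"
  and msqrt_square: "psd A \<Longrightarrow> msqrt A ** msqrt A = A"
  using psd_sqrt_exists msqrt_eqI by blast+

lemma adj_msqrt: "psd A \<Longrightarrow> adj (msqrt A) = msqrt A"
  by (simp add: psd_adj psd_msqrt)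

text \<open>Such an \<open>X\<close> is a multiple of a projection; if \<open>Tr X = 0\<close> then \<open>X = 0\<close>, and the division
  by \<open>0\<close> in the root \<open>X / sqrt (Tr X)\<close> is harmless.\<close>

lemma Tr_msqrt_multiple_of_projection:
  assumes "psd X" "X ** X = Tr X *\<^sub>R X"
  shows "Tr (msqrt X) = sqrt (Tr X)"
proof -
  have "0 \<le> Tr X"
    using assms(1) by (rule psd_Tr_nonneg)
  have "msqrt X = (1 / sqrt (Tr X)) *\<^sub>R X"
  proof (rule msqrt_eqI)
    show "psd ((1 / sqrt (Tr X)) *\<^sub>R X)"
      using assms(1) \<open>0 \<le> Tr X\<close> by (simp add: psd_scaleR)
    show "(1 / sqrt (Tr X)) *\<^sub>R X ** (1 / sqrt (Tr X)) *\<^sub>R X = X"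
      using \<open>0 \<le> Tr X\<close> psd_Tr_eq_0_iff[OF assms(1)] by (simp add: matrix_mult_scaleR assms(2))
  qed
  then show ?thesis
    using \<open>0 \<le> Tr X\<close> by (simp add: trace_scaleR real_div_sqrt)
qed

section \<open>The trace norm as a maximum over contractions\<close>

text \<open>Contractions take the place of unitaries in the variational formula, so partial
  isometries need not be extended to unitaries.\<close>

definition contraction :: "complex ^ 'n ^ 'n \<Rightarrow> bool" where
  "contraction U \<longleftrightarrow> (\<forall>x. norm (U *v x) \<le> norm x)"

text \<open>Apply Cauchy-Schwarz to the squared norm of \<open>adj U *v x\<close> and cancel one
  factor.\<close>

lemma contraction_adj:
  assumes "contraction U"
  shows "contraction (adj U)"
  unfolding contraction_def
proof
  fix x
  let ?y = "adj U *v x"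
  have "norm ?y * norm ?y = inner x (U *v ?y)"
    using inner_adj_left[of U x ?y] by (simp add: power2_eq_square flip: power2_norm_eq_inner)
  also have "\<dots> \<le> norm x * norm (U *v ?y)"
    by (rule norm_cauchy_schwarz)
  also have "\<dots> \<le> norm x * norm ?y"
    using assms by (simp add: contraction_def mult_left_mono)
  finally show "norm ?y \<le> norm x"
    by (cases "?y = 0") simp_all
qed

lemma contraction_projection:
  assumes "adj P = P" "P ** P = P"
  shows "contraction P"
  unfolding contraction_def
proof
  fix x
  have "norm (P *v x) * norm (P *v x) = inner x (P *v x)"
    using inner_adj_mult_self[of x P] by (simp add: assms power2_eq_square)
  also have "\<dots> \<le> norm x * norm (P *v x)"
    by (rule norm_cauchy_schwarz)
  finally show "norm (P *v x) \<le> norm x"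
    by (cases "P *v x = 0") simp_all
qed

text \<open>\<open>G\<close> is the Moore--Penrose inverse of \<open>T\<close>, so that \<open>T ** G\<close> is the support projection.\<close>

lemma psd_pseudoinverse:
  assumes "psd T"
  obtains G where "adj G = G" "G ** T ** T = T" "contraction (T ** G)"
proof -
  obtain V l where V: "onb V" "T = onb_diag V l"
    using psd_spectral[OF assms] by blast
  \<comment> \<open>Since \<open>1 / 0 = 0\<close>, this inverts the nonzero eigenvalues and
    vanishes on the kernel of \<open>T\<close>.\<close>
  define G where "G = onb_diag V (\<lambda>v. 1 / l v)"
  have diag: "G ** T ** T = onb_diag V (\<lambda>v. 1 / l v * l v * l v)"
    "T ** G = onb_diag V (\<lambda>v. l v * (1 / l v))"
    "T ** G ** (T ** G) = onb_diag V (\<lambda>v. l v * (1 / l v) * (l v * (1 / l v)))"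
    by (simp_all only: G_def V(2) onb_diag_mult[OF V(1)])
  show ?thesis
  proof (rule that)
    show "adj G = G"
      by (simp add: G_def)
    show "G ** T ** T = T"
      unfolding diag(1) unfolding V(2) by (rule onb_diag_cong) simp
    have "T ** G ** (T ** G) = T ** G"
      unfolding diag(3) unfolding diag(2) by (rule onb_diag_cong) simp
    then show "contraction (T ** G)"
      by (intro contraction_projection) (simp_all add: diag(2))
  qed
qed

text \<open>Domination of \<open>X\<close> by \<open>T\<close>, read at \<open>G *v x\<close>. This
  yields the contractive factor when \<open>X\<close> is divided by \<open>T\<close>, as in Douglas
  factorisation.\<close>

lemma contraction_mult_pseudoinverse:
  assumes "contraction (T ** G)" "\<And>x. norm (X *v x) \<le> norm (T *v x)"
  shows "contraction (X ** G)"
  unfolding contraction_def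
proof
  fix x
  have "norm ((X ** G) *v x) \<le> norm ((T ** G) *v x)"
    using assms(2)[of "G *v x"] by (simp add: matrix_vector_mul_assoc)
  also have "\<dots> \<le> norm x"
    using assms(1) by (simp add: contraction_def)
  finally show "norm ((X ** G) *v x) \<le> norm x" .
qed

text \<open>Both squared norms equal the quadratic form of \<open>adj X ** X\<close>.\<close>

lemma norm_msqrt_adj_mult_self: "norm (msqrt (adj X ** X) *v x) = norm (X *v x)"
proof -
  let ?M = "msqrt (adj X ** X)"
  have "(norm (?M *v x))\<^sup>2 = inner x ((adj X ** X) *v x)"
    using inner_adj_mult_self[of x ?M]
    by (simp add: adj_msqrt msqrt_square psd_adj_mult_self)
  then show ?thesis
    by (simp add: inner_adj_mult_self)
qed

text \<open>In an eigenbasis of the modulus \<open>?M\<close> of \<open>X\<close>, each diagonal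
  entry of \<open>U ** X\<close> is at most \<open>norm (X *v v)\<close>, which is the eigenvalue of
  \<open>?M\<close> at \<open>v\<close>.\<close>

lemma Tr_contraction_le_trace_norm:
  assumes "contraction U"
  shows "Tr (U ** X) \<le> trace_norm X"
proof -
  let ?M = "msqrt (adj X ** X)"
  obtain S l where S: "onb S" "?M = onb_diag S l" "\<And>v. v \<in> S \<Longrightarrow> 0 \<le> l v"
    using psd_spectral[OF psd_msqrt[OF psd_adj_mult_self]] by blast
  have "Tr (U ** X) = (\<Sum>v\<in>S. inner v (U *v (X *v v)))"
    using S(1) by (simp add: onb_Tr flip: matrix_vector_mul_assoc)
  also have "\<dots> \<le> (\<Sum>v\<in>S. inner v (?M *v v))"
  proof (rule sum_mono)
    fix v assume v: "v \<in> S"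
    have "inner v (U *v (X *v v)) \<le> norm v * norm (U *v (X *v v))"
      by (rule norm_cauchy_schwarz)
    also have "\<dots> \<le> norm (X *v v)"
      using assms onb_norm[OF S(1) v] by (simp add: contraction_def)
    also have "\<dots> = norm (?M *v v)"
      by (simp add: norm_msqrt_adj_mult_self)
    also have "\<dots> = inner v (?M *v v)"
      using S(3)[OF v] onb_norm[OF S(1) v]
      by (simp add: S(2) onb_diag_eigenvector[OF S(1) v] flip: power2_norm_eq_inner)
    finally show "inner v (U *v (X *v v)) \<le> inner v (?M *v v)" .
  qed
  also have "\<dots> = trace_norm X"
    using S(1) by (simp add: trace_norm_def onb_Tr)
  finally show ?thesis .
qed

text \<open>With \<open>G\<close> the pseudoinverse of the modulus \<open>?M\<close>, the matrix
  \<open>X ** G\<close> is the partial isometry of the polar decomposition; its adjoint maps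
  \<open>X\<close> back to \<open>?M\<close>.\<close>

lemma trace_norm_attained:
  obtains U where "contraction U" "Tr (U ** X) = trace_norm X"
proof -
  let ?M = "msqrt (adj X ** X)"
  obtain G where G: "adj G = G" "G ** ?M ** ?M = ?M" "contraction (?M ** G)"
    by (rule psd_pseudoinverse[OF psd_msqrt[OF psd_adj_mult_self]])
  have "contraction (adj (X ** G))"
    by (rule contraction_adj[OF contraction_mult_pseudoinverse[OF G(3)]])
      (simp add: norm_msqrt_adj_mult_self)
  moreover have "adj (X ** G) ** X = G ** ?M ** ?M"
    by (simp add: adj_mult G(1) msqrt_square psd_adj_mult_self flip: matrix_mul_assoc)
  then have "Tr (adj (X ** G) ** X) = trace_norm X"
    by (simp add: G(2) trace_norm_def)
  ultimately show ?thesis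
    by (rule that)
qed

section \<open>Discrimination error and fidelity\<close>

abbreviation is_test :: "complex ^ 'n ^ 'n \<Rightarrow> bool" where
  "is_test E \<equiv> loewner_le 0 E \<and> loewner_le E (mat 1)"

abbreviation test_error ::
  "complex ^ 'n ^ 'n \<Rightarrow> complex ^ 'n ^ 'n \<Rightarrow> complex ^ 'n ^ 'n \<Rightarrow> real" where
  "test_error A B E \<equiv> Tr (A ** (mat 1 - E)) + Tr (B ** E)"

lemma test_psd:
  assumes "is_test E"
  shows "psd E" "psd (mat 1 - E)"
  using assms by (simp_all add: loewner_le_def)

text \<open>Both \<open>P\<close> and \<open>mat 1 - P\<close> have the form
  \<open>adj Y ** Y\<close>, with \<open>Y\<close> the matrix itself.\<close>

lemma projection_is_test:
  assumes "adj P = P" "P ** P = P"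
  shows "is_test P"
  using psd_adj_mult_self[of P] psd_adj_mult_self[of "mat 1 - P"] assms
  by (simp add: loewner_le_def adj_diff matrix_mult_diff)

lemma opt_error_le:
  assumes "psd A" "psd B" "is_test E"
  shows "opt_error A B \<le> test_error A B E"
  unfolding opt_error_def
proof (rule cINF_lower)
  show "bdd_below (test_error A B ` {E. is_test E})"
    using assms(1,2) test_psd
    by (intro bdd_belowI[of _ 0]) (auto intro!: add_nonneg_nonneg Tr_mult_psd_nonneg)
qed (use assms(3) in simp)

lemma opt_error_greatest:
  fixes A :: "complex ^ 'n ^ 'n"
  assumes "\<And>E. is_test E \<Longrightarrow> c \<le> test_error A B E"
  shows "c \<le> opt_error A B"
  unfolding opt_error_def
proof (rule cINF_greatest)
  have "is_test (mat 1 :: complex ^ 'n ^ 'n)"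
    by (rule projection_is_test) simp_all
  then show "{E :: complex ^ 'n ^ 'n. is_test E} \<noteq> {}"
    by blast
qed (use assms in simp)

lemma opt_error_nonneg:
  assumes "psd A" "psd B"
  shows "0 \<le> opt_error A B"
  using assms test_psd by (intro opt_error_greatest add_nonneg_nonneg Tr_mult_psd_nonneg)

text \<open>The optimal test for the square roots \<open>S\<close> and \<open>T\<close>, the projection onto the positive part of
  \<open>S - T\<close>, already achieves the bound of Powers and Stormer.\<close>

lemma opt_error_le_Tr_msqrt_mult:
  assumes "psd A" "psd B"
  shows "opt_error A B \<le> Tr (msqrt A ** msqrt B)"
proof -
  define S where "S = msqrt A"
  define T where "T = msqrt B"
  have S: "psd S" "S ** S = A" and T: "psd T" "T ** T = B"
    using assms by (simp_all add: S_def T_def psd_msqrt msqrt_square)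
  have "adj (S - T) = S - T"
    using S T by (simp add: adj_diff psd_adj)
  then obtain V d where V: "onb V" and d: "\<And>v. v \<in> V \<Longrightarrow> (S - T) *v v = d v *\<^sub>R v"
    using spectral_theorem by blast
  define e where "e = (\<lambda>v. if 0 < d v then 1 else 0 :: real)"
  define E where "E = onb_diag V e"
  have "(\<lambda>v. e v * e v) = e"
    by (auto simp: e_def)
  then have "is_test E"
    by (intro projection_is_test) (simp_all add: E_def onb_diag_mult[OF V])
  then have "opt_error A B \<le> test_error A B E"
    using assms by (intro opt_error_le)
  also have "\<dots> = Tr A - Tr ((A - B) ** E)"
    by (simp add: matrix_mult_diff trace_sub)
  \<comment> \<open>As \<open>A - B\<close> is \<open>S ** S - T ** T\<close>, its quadratic form is
    known at the eigenvectors of \<open>S - T\<close>.\<close>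
  also have "Tr ((A - B) ** E) = (\<Sum>v\<in>V. e v * (d v * inner v ((S + T) *v v)))"
    using inner_square_diff[OF psd_adj psd_adj d, OF S(1) T(1)]
    by (simp add: onb_Tr[OF V] E_def onb_diag_eigenvector[OF V] matrix_vector_scaleR S(2) T(2)
        flip: matrix_vector_mul_assoc)
  also have "Tr A - \<dots> \<le> Tr A - (\<Sum>v\<in>V. d v * inner v (S *v v))"
  proof (intro diff_left_mono sum_mono)
    fix v
    have "0 \<le> inner v (S *v v)" "0 \<le> inner v (T *v v)"
      using S(1) T(1) by (simp_all add: psd_inner_nonneg)
    \<comment> \<open>For \<open>0 < d v\<close> the right side has the additional term
      \<open>d v * inner v (T *v v)\<close>; otherwise the right side is \<open>0\<close> and the
      left side is not positive.\<close>
    then show "d v * inner v (S *v v) \<le> e v * (d v * inner v ((S + T) *v v))"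
      by (simp add: e_def matrix_vector_mult_add_rdistrib inner_add_right mult_nonpos_nonneg)
  qed
  also have "(\<Sum>v\<in>V. d v * inner v (S *v v)) = Tr (S ** (S - T))"
    by (simp add: onb_Tr[OF V] d matrix_vector_scaleR flip: matrix_vector_mul_assoc)
  also have "Tr A - Tr (S ** (S - T)) = Tr (S ** T)"
    by (simp add: matrix_mult_diff trace_sub S(2))
  finally show ?thesis
    by (simp add: S_def T_def)
qed

text \<open>With \<open>T\<close> the root of the sum of the \<open>B j\<close> and \<open>G\<close> its pseudoinverse, \<open>T\<close> is the sum of
  the \<open>msqrt (B j) ** C j\<close>, where the matrices \<open>C j = msqrt (B j) ** G\<close> are contractions.\<close>

lemma Tr_msqrt_mult_sum_le_fidelity:
  assumes "finite J" "psd A" "\<And>j. j \<in> J \<Longrightarrow> psd (B j)"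
  shows "Tr (msqrt A ** msqrt (\<Sum>j\<in>J. B j)) \<le> (\<Sum>j\<in>J. fidelity A (B j))"
proof -
  define T where "T = msqrt (\<Sum>j\<in>J. B j)"
  define R where "R = (\<lambda>j. msqrt (B j))"
  have sum_psd: "psd (\<Sum>j\<in>J. B j)"
    using assms(3) by (rule psd_sum)
  have T: "psd T" "T ** T = (\<Sum>j\<in>J. B j)"
    using sum_psd by (simp_all add: T_def psd_msqrt msqrt_square)
  have R: "adj (R j) = R j" "R j ** R j = B j" if "j \<in> J" for j
    using assms(3)[OF that] by (simp_all add: R_def adj_msqrt msqrt_square)
  obtain G where G: "adj G = G" "G ** T ** T = T" "contraction (T ** G)"
    by (rule psd_pseudoinverse[OF T(1)])
  \<comment> \<open>Each \<open>B j\<close> is dominated by the sum \<open>T ** T\<close>, which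
    compares the norms of \<open>R j *v x\<close> and \<open>T *v x\<close>.\<close>
  have contr: "contraction (R j ** G)" if "j \<in> J" for j
  proof (rule contraction_mult_pseudoinverse[OF G(3)])
    fix x
    have "(norm (R j *v x))\<^sup>2 = inner x (B j *v x)"
      using inner_adj_mult_self[of x "R j"] R[OF that] by simp
    also have "\<dots> \<le> (\<Sum>j\<in>J. inner x (B j *v x))"
      using assms that by (intro member_le_sum) (simp_all add: psd_inner_nonneg)
    also have "\<dots> = (norm (T *v x))\<^sup>2"
      using inner_adj_mult_self[of x T]
      by (simp add: psd_adj[OF T(1)] T(2) sum_matrix_vector_mult inner_sum_right)
    finally show "norm (R j *v x) \<le> norm (T *v x)"
      by (rule power2_le_imp_le) simp
  qed
  have "T = G ** T ** T"
    by (simp add: G(2))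
  also have "\<dots> = (\<Sum>j\<in>J. G ** (R j ** R j))"
    using R(2) by (simp add: T(2) matrix_mult_sum_right flip: matrix_mul_assoc)
  \<comment> \<open>Adjoints move \<open>G\<close> to the right, so that each summand ends in the
    contraction \<open>R j ** G\<close>; cyclicity of the trace later brings it to the
    front.\<close>
  finally have "adj T = adj (\<Sum>j\<in>J. G ** (R j ** R j))"
    by simp
  then have "T = (\<Sum>j\<in>J. R j ** R j ** G)"
    using R(1) by (simp add: adj_sum adj_mult G(1) psd_adj[OF T(1)])
  then have "Tr (msqrt A ** T) = Tr (msqrt A ** (\<Sum>j\<in>J. R j ** R j ** G))"
    by simp
  also have "\<dots> = (\<Sum>j\<in>J. Tr ((msqrt A ** R j) ** (R j ** G)))"
    by (simp add: matrix_mult_sum_right trace_sum matrix_mul_assoc)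
  also have "\<dots> = (\<Sum>j\<in>J. Tr ((R j ** G) ** (msqrt A ** R j)))"
    by (simp only: trace_mul_sym[of "msqrt A ** _"])
  also have "\<dots> \<le> (\<Sum>j\<in>J. fidelity A (B j))"
    using Tr_contraction_le_trace_norm[OF contr] by (intro sum_mono) (simp add: fidelity_def R_def)
  finally show ?thesis
    by (simp add: T_def)
qed

section \<open>Hilbert-Schmidt estimates and the bound of the fidelity by the error\<close>

lemma norm_matrix_onb:
  assumes "onb V"
  shows "(norm X)\<^sup>2 = (\<Sum>v\<in>V. (norm (X *v v))\<^sup>2)"
  using Tr_adj_mult_eq_inner[of X X] inner_adj_mult_self[of _ X]
  by (simp add: onb_Tr[OF assms] power2_norm_eq_inner)

lemma norm_contraction_mult_le:
  fixes U X :: "complex ^ 'n ^ 'n"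
  assumes "contraction U"
  shows "norm (U ** X) \<le> norm X"
proof -
  \<comment> \<open>The identity matrix only serves to supply some orthonormal basis.\<close>
  obtain V :: "(complex ^ 'n) set" where "onb V"
    using spectral_theorem[of "mat 1"] by auto
  have "(norm (U ** X))\<^sup>2 \<le> (norm X)\<^sup>2"
    unfolding norm_matrix_onb[OF \<open>onb V\<close>]
    using assms by (intro sum_mono power_mono)
      (simp_all add: contraction_def flip: matrix_vector_mul_assoc)
  then show ?thesis
    by (rule power2_le_imp_le) simp
qed

text \<open>Split \<open>E\<close> as \<open>R ** R\<close> and apply Hilbert-Schmidt Cauchy-Schwarz
  to \<open>U ** (S ** R)\<close> and \<open>R ** T\<close>; the contraction does not increase the
  norm.\<close>

lemma Tr_contraction_cauchy_schwarz:
  assumes "contraction U" "adj S = S" "adj T = T" "psd E"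
  shows "Tr (U ** (S ** E ** T)) \<le> sqrt (Tr (S ** S ** E)) * sqrt (Tr (T ** T ** E))"
proof -
  define R where "R = msqrt E"
  have R: "adj R = R" "R ** R = E"
    using assms(4) by (simp_all add: R_def adj_msqrt msqrt_square)
  have norm_R: "norm (R ** X) = sqrt (Tr (X ** X ** E))" if "adj X = X" for X
  proof -
    have "(norm (R ** X))\<^sup>2 = Tr (X ** (E ** X))"
      using Tr_adj_mult_eq_inner[of "R ** X" "R ** X"] that R
      by (simp add: adj_mult power2_norm_eq_inner matrix_mul_assoc) (simp flip: matrix_mul_assoc)
    also have "\<dots> = Tr (X ** X ** E)"
      using trace_mul_sym[of "X ** E" X] by (simp add: matrix_mul_assoc)
    finally show ?thesis
      by (metis norm_ge_zero real_sqrt_unique)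
  qed
  have "U ** (S ** E ** T) = adj (adj (U ** (S ** R))) ** (R ** T)"
    by (simp add: matrix_mul_assoc flip: R(2))
  then have "Tr (U ** (S ** E ** T)) = inner (adj (U ** (S ** R))) (R ** T)"
    by (simp only: Tr_adj_mult_eq_inner)
  also have "\<dots> \<le> norm (adj (U ** (S ** R))) * norm (R ** T)"
    by (rule norm_cauchy_schwarz)
  also have "\<dots> \<le> norm (S ** R) * norm (R ** T)"
    unfolding norm_adj by (simp add: mult_right_mono norm_contraction_mult_le[OF assms(1)])
  also have "norm (S ** R) = norm (R ** S)"
    using norm_adj[of "R ** S"] by (simp add: adj_mult R(1) assms(2))
  finally show ?thesis
    by (simp add: norm_R assms(2,3))
qed

lemma fidelity_nonneg: "0 \<le> fidelity A B"
  by (simp add: fidelity_def trace_norm_def psd_Tr_nonneg psd_msqrt psd_adj_mult_self)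

lemma fidelity_square_le_test_error:
  assumes "psd A" "psd B" "is_test E"
  shows "(fidelity A B)\<^sup>2 \<le> Tr (A + B) * test_error A B E"
proof -
  define S where "S = msqrt A"
  define T where "T = msqrt B"
  have S: "adj S = S" "S ** S = A" and T: "adj T = T" "T ** T = B"
    using assms by (simp_all add: S_def T_def adj_msqrt msqrt_square)
  obtain U where U: "contraction U" "Tr (U ** (S ** T)) = fidelity A B"
    using trace_norm_attained[of "S ** T"] by (auto simp: fidelity_def S_def T_def)
  note E = test_psd[OF assms(3)]
  define p q r s where "p = sqrt (Tr (A ** E))" and "q = sqrt (Tr (B ** E))"
    and "r = sqrt (Tr (B ** (mat 1 - E)))" and "s = sqrt (Tr (A ** (mat 1 - E)))"
  have sq: "p\<^sup>2 = Tr (A ** E)" "q\<^sup>2 = Tr (B ** E)"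
    "r\<^sup>2 = Tr (B ** (mat 1 - E))" "s\<^sup>2 = Tr (A ** (mat 1 - E))"
    using assms(1,2) E by (simp_all add: p_def q_def r_def s_def Tr_mult_psd_nonneg)
  have "S ** T = S ** E ** T + S ** (mat 1 - E) ** T"
    by (simp add: matrix_mult_diff)
  then have "fidelity A B = Tr (U ** (S ** E ** T)) + Tr (U ** (S ** (mat 1 - E) ** T))"
    using U(2) by (simp add: matrix_add_ldistrib trace_add)
  also have "\<dots> \<le> p * q + s * r"
    using Tr_contraction_cauchy_schwarz[OF U(1) S(1) T(1)] E
    by (intro add_mono) (simp_all add: p_def q_def r_def s_def S(2) T(2))
  finally have "(fidelity A B)\<^sup>2 \<le> (p * q + s * r)\<^sup>2"
    using fidelity_nonneg by (rule power_mono)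
  \<comment> \<open>Cauchy-Schwarz for the pairs \<open>(p, r)\<close> and \<open>(q, s)\<close>;
    the defect is the square of \<open>p * s - q * r\<close>. The second factor is the error of
    \<open>E\<close>, the first the complementary part of the total trace.\<close>
  also have "\<dots> \<le> (p\<^sup>2 + r\<^sup>2) * (s\<^sup>2 + q\<^sup>2)"
    using zero_le_power2[of "p * s - q * r"] by (simp add: algebra_simps power2_eq_square)
  also have "\<dots> \<le> Tr (A + B) * (s\<^sup>2 + q\<^sup>2)"
  proof (rule mult_right_mono)
    have "Tr (A + B) = (p\<^sup>2 + r\<^sup>2) + (s\<^sup>2 + q\<^sup>2)"
      by (simp add: sq matrix_mult_diff trace_sub trace_add)
    then show "p\<^sup>2 + r\<^sup>2 \<le> Tr (A + B)"
      by simp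
  qed simp
  finally show ?thesis
    by (simp add: sq)
qed

text \<open>Dividing by the positive total trace gives a lower bound common to all tests, hence one
  for their infimum.\<close>

lemma fidelity_square_le_opt_error:
  assumes "psd A" "psd B" "A \<noteq> 0"
  shows "(fidelity A B)\<^sup>2 \<le> Tr (A + B) * opt_error A B"
proof -
  have "0 < Tr (A + B)"
    using psd_Tr_nonneg[OF assms(1)] psd_Tr_nonneg[OF assms(2)] psd_Tr_eq_0_iff[OF assms(1)]
      assms(3) by (simp add: trace_add)
  moreover have "(fidelity A B)\<^sup>2 / Tr (A + B) \<le> opt_error A B"
    using fidelity_square_le_test_error[OF assms(1,2)] \<open>0 < Tr (A + B)\<close>
    by (intro opt_error_greatest) (simp add: pos_divide_le_eq mult.commute)
  ultimately show ?thesis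
    by (simp add: pos_divide_le_eq mult.commute)
qed

section \<open>Rank one\<close>

text \<open>All rows are multiples of one vector \<open>b\<close>, so the entries of
  \<open>A\<close> are \<open>k i * b $ j\<close> and the middle of the product collapses to a
  scalar. The multiple is written entrywise because this scalar is complex.\<close>

lemma rank_1_sandwich:
  fixes A X :: "complex ^ 'n ^ 'n"
  assumes "rank A = 1"
  shows "A ** X ** A = (\<chi> i j. trace (A ** X) * A $ i $ j)"
proof -
  obtain C where C: "rows A \<subseteq> vec.span C" "card C = 1"
    using vec.basis_exists[of "rows A"] assms unfolding row_rank_def_gen by metis
  then obtain b where "C = {b}"
    by (auto simp: card_1_singleton_iff)
  then have "\<exists>k. A $ i = k *s b" for i
    using C(1) by (auto simp: rows_def row_def vec.span_singleton)
  then obtain k where k: "\<And>i. A $ i = k i *s b"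
    by metis
  then have A: "A $ i $ j = k i * b $ j" for i j
    by simp
  show ?thesis
    unfolding vec_eq_iff
  proof safe
    fix i j
    have "(A ** X ** A) $ i $ j = (\<Sum>m\<in>UNIV. \<Sum>l\<in>UNIV. k i * b $ l * X $ l $ m * (k m * b $ j))"
      by (simp add: matrix_matrix_mult_def A sum_distrib_right)
    also have "\<dots> = (\<Sum>m\<in>UNIV. \<Sum>l\<in>UNIV. k m * b $ l * X $ l $ m) * (k i * b $ j)"
      by (simp add: sum_distrib_left sum_distrib_right mult_ac)
    also have "\<dots> = trace (A ** X) * A $ i $ j"
      by (simp add: trace_def matrix_matrix_mult_def A)
    finally show "(A ** X ** A) $ i $ j = (\<chi> i j. trace (A ** X) * A $ i $ j) $ i $ j"
      by simp
  qed
qed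

text \<open>The trace of a product of two Hermitian matrices is real, by taking adjoints and using
  cyclicity.\<close>

lemma psd_rank_1_sandwich:
  assumes "psd A" "psd B" "rank A = 1"
  shows "A ** B ** A = Tr (A ** B) *\<^sub>R A"
proof -
  have "cnj (trace (A ** B)) = trace (A ** B)"
    using trace_adj[of "A ** B"] assms(1,2) by (simp add: adj_mult psd_adj trace_mul_sym[of A])
  then have "trace (A ** B) = of_real (Tr (A ** B))"
    by (simp add: complex_eq_iff)
  then show ?thesis
    unfolding rank_1_sandwich[OF assms(3)]
    by (simp add: vec_eq_iff scaleR_conv_of_real[where 'a = complex])
qed

text \<open>The sandwich identity makes \<open>T ** A ** T\<close> a multiple of a projection, so
  the trace of its root is the root of its trace. Assuming the identity instead of the rank lets the
  lemma apply directly to rescaled operators.\<close>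

lemma fidelity_square_rank_1:
  assumes "psd A" "psd B" "A ** B ** A = Tr (A ** B) *\<^sub>R A"
  shows "(fidelity A B)\<^sup>2 = Tr (A ** B)"
proof -
  define S where "S = msqrt A"
  define T where "T = msqrt B"
  have S: "adj S = S" "S ** S = A" and T: "adj T = T" "T ** T = B"
    using assms by (simp_all add: S_def T_def adj_msqrt msqrt_square)
  let ?X = "adj (S ** T) ** (S ** T)"
  have X: "?X = T ** A ** T"
    by (simp add: adj_mult S T flip: S(2) add: matrix_mul_assoc)
  have TrX: "Tr ?X = Tr (A ** B)"
    using trace_mul_sym[of T "A ** T"] by (simp add: X flip: T(2) matrix_mul_assoc)
  have "?X ** ?X = T ** (A ** B ** A) ** T"
    by (simp add: X flip: T(2) matrix_mul_assoc)
  also have "\<dots> = Tr (A ** B) *\<^sub>R (T ** A ** T)"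
    by (simp add: assms(3) matrix_mult_scaleR)
  also have "\<dots> = Tr ?X *\<^sub>R ?X"
    by (simp only: TrX flip: X)
  finally have "Tr (msqrt ?X) = sqrt (Tr ?X)"
    by (rule Tr_msqrt_multiple_of_projection[OF psd_adj_mult_self])
  then have "fidelity A B = sqrt (Tr (A ** B))"
    unfolding TrX by (simp add: fidelity_def trace_norm_def S_def T_def)
  then show ?thesis
    using Tr_mult_psd_nonneg[OF assms(1,2)] by simp
qed

lemma psd_Tr_pos: "psd A \<Longrightarrow> A \<noteq> 0 \<Longrightarrow> 0 < Tr A"
  using psd_Tr_nonneg[of A] psd_Tr_eq_0_iff[of A] by linarith

text \<open>The sandwich identity around \<open>mat 1\<close> shows that \<open>P\<close> is a
  projection; its error on \<open>A\<close> is zero, and only the \<open>B\<close> term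
  remains.\<close>

lemma opt_error_rank_1_le:
  assumes "psd A" "psd B" "A \<noteq> 0" "rank A = 1"
  shows "opt_error A B \<le> Tr (A ** B) / Tr A"
proof -
  note pos = psd_Tr_pos[OF assms(1,3)]
  define P where "P = A /\<^sub>R Tr A"
  have "psd (mat 1 :: complex ^ 'n ^ 'n)"
    using psd_adj_mult_self[of "mat 1"] by simp
  from psd_rank_1_sandwich[OF assms(1) this assms(4)] have AA: "A ** A = Tr A *\<^sub>R A"
    by simp
  have "is_test P"
    using pos assms(1)
    by (intro projection_is_test) (simp_all add: P_def adj_scaleR psd_adj matrix_mult_scaleR AA)
  then have "opt_error A B \<le> test_error A B P"
    using assms by (intro opt_error_le)
  also have "\<dots> = Tr (A ** B) / Tr A"
    using pos
    by (simp add: P_def matrix_mult_diff matrix_mult_scaleR trace_sub AA trace_scaleR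
        trace_mul_sym[of B] divide_inverse mult.commute)
  finally show ?thesis .
qed

text \<open>Both squared fidelities are traces of products, and these are bilinear.\<close>

lemma fidelity_square_normalized_rank_1:
  assumes "psd A" "psd B" "rank A = 1"
  shows "(fidelity (A /\<^sub>R Tr A) (B /\<^sub>R Tr B))\<^sup>2 = (fidelity A B)\<^sup>2 / (Tr A * Tr B)"
proof -
  note s = psd_rank_1_sandwich[OF assms]
  have "(fidelity (A /\<^sub>R Tr A) (B /\<^sub>R Tr B))\<^sup>2 = Tr ((A /\<^sub>R Tr A) ** (B /\<^sub>R Tr B))"
    using assms(1,2)
    by (intro fidelity_square_rank_1)
      (simp_all add: psd_scaleR psd_Tr_nonneg matrix_mult_scaleR s trace_scaleR)
  also have "\<dots> = Tr (A ** B) / (Tr A * Tr B)"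
    by (simp add: matrix_mult_scaleR trace_scaleR divide_inverse)
  finally show ?thesis
    using fidelity_square_rank_1[OF assms(1,2) s] by simp
qed

section \<open>The inequality chains for a sum of alternatives\<close>

theorem theorem4p3:
  fixes A :: "complex ^ 'n ^ 'n" and B :: "nat \<Rightarrow> complex ^ 'n ^ 'n" and r :: nat
  assumes "r \<ge> 1"
    and "psd A" and "A \<noteq> 0"
    and "\<And>j. j \<in> {1..r} \<Longrightarrow> psd (B j)" and "\<And>j. j \<in> {1..r} \<Longrightarrow> B j \<noteq> 0"
  shows "opt_error A (\<Sum>j=1..r. B j) \<le> (\<Sum>j=1..r. fidelity A (B j)) \<and>
    (\<Sum>j=1..r. fidelity A (B j))
      \<le> (\<Sum>j=1..r. sqrt (Tr (A + B j)) * sqrt (opt_error A (B j))) \<and>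
    (rank A = 1 \<longrightarrow>
      opt_error A (\<Sum>j=1..r. B j)
        \<le> (\<Sum>j=1..r. Tr (B j)) *
          (\<Sum>j=1..r. (fidelity (A /\<^sub>R Tr A) (B j /\<^sub>R Tr (B j)))\<^sup>2) \<and>
      (\<Sum>j=1..r. Tr (B j)) *
          (\<Sum>j=1..r. (fidelity (A /\<^sub>R Tr A) (B j /\<^sub>R Tr (B j)))\<^sup>2)
        \<le> (\<Sum>j=1..r. Tr (B j)) *
          (\<Sum>j=1..r. (Tr A + Tr (B j)) / (Tr A * Tr (B j)) * opt_error A (B j)) \<and>
      opt_error A (\<Sum>j=1..r. B j)
        \<le> (\<Sum>j=1..r. sqrt (1 + Tr (B j) / Tr A) * sqrt (opt_error A (B j)))\<^sup>2 \<and>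
      (\<Sum>j=1..r. sqrt (1 + Tr (B j) / Tr A) * sqrt (opt_error A (B j)))\<^sup>2
        \<le> (\<Sum>j=1..r. 1 + Tr (B j) / Tr A) * (\<Sum>j=1..r. opt_error A (B j)))"
proof -
  let ?J = "{1..r}"
  note A = assms(2,3) and B = assms(4)
  have sum_psd: "psd (\<Sum>j\<in>?J. B j)"
    using B by (rule psd_sum)
  have A_pos: "0 < Tr A"
    using A by (rule psd_Tr_pos)
  have B_pos: "0 < Tr (B j)" if "j \<in> ?J" for j
    using assms(4,5)[OF that] by (rule psd_Tr_pos)
  have err_nonneg: "0 \<le> opt_error A (B j)" if "j \<in> ?J" for j
    using A(1) B[OF that] by (rule opt_error_nonneg)
  have F_sq: "(fidelity A (B j))\<^sup>2 \<le> (Tr A + Tr (B j)) * opt_error A (B j)" if "j \<in> ?J" for j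
    using fidelity_square_le_opt_error[OF A(1) B[OF that] A(2)] by (simp add: trace_add)
  have "opt_error A (\<Sum>j\<in>?J. B j) \<le> (\<Sum>j\<in>?J. fidelity A (B j))"
    using opt_error_le_Tr_msqrt_mult[OF A(1) sum_psd]
      Tr_msqrt_mult_sum_le_fidelity[of ?J A B] A(1) B by simp
  moreover have "(\<Sum>j\<in>?J. fidelity A (B j))
      \<le> (\<Sum>j\<in>?J. sqrt (Tr (A + B j)) * sqrt (opt_error A (B j)))"
    using F_sq by (intro sum_mono) (simp add: trace_add real_le_rsqrt flip: real_sqrt_mult)
  moreover have
    "opt_error A (\<Sum>j\<in>?J. B j) \<le> (\<Sum>j\<in>?J. Tr (B j)) *
      (\<Sum>j\<in>?J. (fidelity (A /\<^sub>R Tr A) (B j /\<^sub>R Tr (B j)))\<^sup>2)" (is ?c1)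
    "(\<Sum>j\<in>?J. Tr (B j)) * (\<Sum>j\<in>?J. (fidelity (A /\<^sub>R Tr A) (B j /\<^sub>R Tr (B j)))\<^sup>2)
      \<le> (\<Sum>j\<in>?J. Tr (B j)) *
        (\<Sum>j\<in>?J. (Tr A + Tr (B j)) / (Tr A * Tr (B j)) * opt_error A (B j))" (is ?c2)
    "opt_error A (\<Sum>j\<in>?J. B j)
      \<le> (\<Sum>j\<in>?J. sqrt (1 + Tr (B j) / Tr A) * sqrt (opt_error A (B j)))\<^sup>2" (is ?c3)
    if rank: "rank A = 1"
  proof -
    note F_normalized = fidelity_square_normalized_rank_1[OF A(1) B rank]
    \<comment> \<open>Both rank-one chains start from this estimate: the test
      \<open>A / Tr A\<close> does not depend on the \<open>B j\<close>, so its error is additive in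
      them.\<close>
    have "opt_error A (\<Sum>j\<in>?J. B j) \<le> Tr (A ** (\<Sum>j\<in>?J. B j)) / Tr A"
      using A sum_psd rank by (intro opt_error_rank_1_le)
    also have "\<dots> = (\<Sum>j\<in>?J. (fidelity A (B j))\<^sup>2 / Tr A)"
      using fidelity_square_rank_1[OF A(1) B psd_rank_1_sandwich[OF A(1) B rank]]
      by (simp add: matrix_mult_sum_right trace_sum sum_divide_distrib)
    finally have err: "opt_error A (\<Sum>j\<in>?J. B j) \<le> \<dots>" .
    also have "\<dots> \<le> (\<Sum>j\<in>?J. (\<Sum>j\<in>?J. Tr (B j)) *
        (fidelity (A /\<^sub>R Tr A) (B j /\<^sub>R Tr (B j)))\<^sup>2)"
    proof (rule sum_mono)
      fix j assume j: "j \<in> ?J"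
      \<comment> \<open>The factor \<open>Tr (B j)\<close> is inserted to normalise
        \<open>B j\<close> and then enlarged to the total trace; the inner sum binds its own
        \<open>j\<close>.\<close>
      have "(fidelity A (B j))\<^sup>2 / Tr A = Tr (B j) * ((fidelity A (B j))\<^sup>2 / (Tr A * Tr (B j)))"
        using B_pos[OF j] by simp
      also have "\<dots> \<le> (\<Sum>j\<in>?J. Tr (B j)) * ((fidelity A (B j))\<^sup>2 / (Tr A * Tr (B j)))"
        using B_pos A_pos j by (intro mult_right_mono member_le_sum) (simp_all add: less_imp_le)
      finally show "(fidelity A (B j))\<^sup>2 / Tr A \<le>
          (\<Sum>j\<in>?J. Tr (B j)) * (fidelity (A /\<^sub>R Tr A) (B j /\<^sub>R Tr (B j)))\<^sup>2"
        by (simp only: F_normalized[OF j])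
    qed
    finally show ?c1
      by (simp only: sum_distrib_left)
    show ?c2
    proof (intro mult_left_mono sum_mono sum_nonneg)
      fix j assume j: "j \<in> ?J"
      show "0 \<le> Tr (B j)"
        using B_pos[OF j] by simp
      show "(fidelity (A /\<^sub>R Tr A) (B j /\<^sub>R Tr (B j)))\<^sup>2
          \<le> (Tr A + Tr (B j)) / (Tr A * Tr (B j)) * opt_error A (B j)"
        using divide_right_mono[OF F_sq[OF j], of "Tr A * Tr (B j)"] A_pos B_pos[OF j]
        by (simp add: F_normalized[OF j])
    qed
    let ?x = "\<lambda>j. sqrt (1 + Tr (B j) / Tr A) * sqrt (opt_error A (B j))"
    note err
    also have "(\<Sum>j\<in>?J. (fidelity A (B j))\<^sup>2 / Tr A) \<le> (\<Sum>j\<in>?J. (?x j)\<^sup>2)"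
    proof (rule sum_mono)
      fix j assume j: "j \<in> ?J"
      \<comment> \<open>This is the right side of \<open>F_sq\<close> divided by
        \<open>Tr A\<close>.\<close>
      have "(?x j)\<^sup>2 = (Tr A + Tr (B j)) * opt_error A (B j) / Tr A"
        using A_pos B_pos[OF j] err_nonneg[OF j]
        by (simp add: power_mult_distrib add_divide_distrib distrib_right)
      then show "(fidelity A (B j))\<^sup>2 / Tr A \<le> (?x j)\<^sup>2"
        using divide_right_mono[OF F_sq[OF j], of "Tr A"] A_pos by simp
    qed
    \<comment> \<open>For nonnegative terms the sum of squares is at most the square of the sum,
      since each term is at most the whole sum.\<close>
    also have "\<dots> \<le> (\<Sum>j\<in>?J. ?x j * (\<Sum>j\<in>?J. ?x j))"
      unfolding power2_eq_square using A_pos B_pos err_nonneg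
      by (intro sum_mono mult_left_mono member_le_sum) (simp_all add: less_imp_le)
    also have "\<dots> = (\<Sum>j\<in>?J. ?x j)\<^sup>2"
      by (simp only: power2_eq_square sum_distrib_right)
    finally show ?c3 .
  qed
  moreover have "(\<Sum>j\<in>?J. sqrt (1 + Tr (B j) / Tr A) * sqrt (opt_error A (B j)))\<^sup>2
      \<le> (\<Sum>j\<in>?J. 1 + Tr (B j) / Tr A) * (\<Sum>j\<in>?J. opt_error A (B j))"
  proof -
    have "(\<Sum>j\<in>?J. (sqrt (1 + Tr (B j) / Tr A))\<^sup>2) = (\<Sum>j\<in>?J. 1 + Tr (B j) / Tr A)"
      using A_pos B_pos by (intro sum.cong) (simp_all add: less_imp_le)
    moreover have "(\<Sum>j\<in>?J. (sqrt (opt_error A (B j)))\<^sup>2) = (\<Sum>j\<in>?J. opt_error A (B j))"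
      using err_nonneg by (intro sum.cong) simp_all
    ultimately show ?thesis
      using Cauchy_Schwarz_ineq_sum[of "\<lambda>j. sqrt (1 + Tr (B j) / Tr A)"
          "\<lambda>j. sqrt (opt_error A (B j))" ?J] by simp
  qed
  ultimately show ?thesis
    by blast
qed

end
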